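(* Let $\rho>0$ and $\kappa=\rho-\rho^{-1}$ be the parameters of the Euler top, and let $I(h)$ be the scaled action of the Euler top, i.e. $I=I_{\beta_+}$ for $0<2h<\rho^{-1}$ or $I=I_{\beta_-}$ for $-\rho<2h<0$ (defined in the context). Then $I$ satisfies the Picard–Fuchs equation $$[w(2h)]^2\,I'''(h)+2(12h^2+4\kappa h-1)\,I''(h)+(6h+\kappa)\,I'(h)=0,$$ with the scaled energy $h$ as the independent variable, where $[w(z)]^2=z(z^2+\kappa z-1)$.
   Context: For the Euler top with moments of inertia $0<\Theta_1<\Theta_2<\Theta_3$, $\rho:=\sqrt{\frac{\Theta_1(\Theta_3-\Theta_2)}{\Theta_3(\Theta_2-\Theta_1)}}$ and $\kappa:=\rho-\rho^{-1}$. Here $h$ is the scaled energy, normalised to $0$ at the unstable equilibrium. With $w(z)^2=z(z^2+\kappa z-1)=z(z+\rho)(z-\rho^{-1})$ and $\zeta(h)=\frac{\sqrt{2h-z}}{w(z)}\,dz$, the scaled discrete-symmetry-reduced actions are $I_{\beta_\pm}(h)=\frac1{4\pi}\oint_{\beta_\pm}\zeta(h)$ for $\pm h>0$, where $\beta_+$ encircles the branch points $2h,\rho^{-1}$ and $\beta_-$ encircles $-\rho,2h$. Explicitly, $$I_{\beta_+}(h)=\frac1{2\pi}\int_{2h}^{\rho^{-1}}\sqrt{\frac{x-2h}{x(x+\rho)(\rho^{-1}-x)}}\,dx,\qquad I_{\beta_-}(h)=\frac1{2\pi}\int_{-\rho}^{2h}\sqrt{\frac{x-2h}{x(x+\rho)(\rho^{-1}-x)}}\,dx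 .$$ *)

theory Defs
  imports "HOL-Analysis.Analysis"
begin

definition euler_rho :: "real \<Rightarrow> real \<Rightarrow> real \<Rightarrow> real" where
  "euler_rho \<Theta>1 \<Theta>2 \<Theta>3 = sqrt ((\<Theta>1 * (\<Theta>3 - \<Theta>2)) / (\<Theta>3 * (\<Theta>2 - \<Theta>1)))"

definition euler_kappa :: "real \<Rightarrow> real" where
  "euler_kappa \<rho> = \<rho> - 1 / \<rho>"

definition w_sq :: "real \<Rightarrow> real \<Rightarrow> real" where
  "w_sq \<kappa> z = z * (z\<^sup>2 + \<kappa> * z - 1)"

text \<open>
  The square root of the following quotient is the integrand of the scaled actions. The quotient
  is the square (2h - x) / w(x)^2 of the coefficient of the differential zeta(h) (see
  \<open>action_integrand_eq\<close>), and it is nonnegative on both intervals of integration.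
\<close>

definition action_integrand :: "real \<Rightarrow> real \<Rightarrow> real \<Rightarrow> real" where
  "action_integrand \<rho> h x = sqrt ((x - 2 * h) / (x * (x + \<rho>) * (1 / \<rho> - x)))"

text \<open>
  Collapsing the cycle \<open>\<beta>\<^sub>\<plusminus>\<close> onto the real segment between its two branch points turns
  1/(4 pi) times the period of zeta(h) into 1/(2 pi) times a real integral.
  The integrand has an integrable singularity at the endpoint 1 / \<rho>, respectively - \<rho>.
\<close>

definition action_plus :: "real \<Rightarrow> real \<Rightarrow> real" where
  "action_plus \<rho> h = 1 / (2 * pi) * integral {2 * h..1 / \<rho>} (action_integrand \<rho> h)"

definition action_minus :: "real \<Rightarrow> real \<Rightarrow> real" where
  "action_minus \<rho> h = 1 / (2 * pi) * integral {- \<rho>..2 * h} (action_integrand \<rho> h)"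

lemma w_sq_factor:
  assumes "\<rho> > 0"
  shows "w_sq (euler_kappa \<rho>) z = z * (z + \<rho>) * (z - 1 / \<rho>)"
  using assms by (simp add: w_sq_def euler_kappa_def field_simps power2_eq_square)

lemma action_integrand_eq:
  assumes "\<rho> > 0"
  shows "action_integrand \<rho> h x = sqrt ((2 * h - x) / w_sq (euler_kappa \<rho>) x)"
proof -
  have "w_sq (euler_kappa \<rho>) x = - (x * (x + \<rho>) * (1 / \<rho> - x))"
    unfolding w_sq_factor[OF assms] by (simp add: algebra_simps)
  moreover have "2 * h - x = - (x - 2 * h)" by simp
  ultimately show ?thesis
    unfolding action_integrand_def by (simp only: minus_divide_left[symmetric] minus_divide_right[symmetric] minus_minus)
qed

text \<open>The moments of inertia realise exactly the positive values of the parameter.\<close>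

lemma euler_rho_pos:
  assumes "0 < \<Theta>1" "\<Theta>1 < \<Theta>2" "\<Theta>2 < \<Theta>3"
  shows "euler_rho \<Theta>1 \<Theta>2 \<Theta>3 > 0"
  using assms by (simp add: euler_rho_def)

lemma euler_rho_surj:
  assumes "\<rho> > 0"
  shows "\<exists>\<Theta>1 \<Theta>2 \<Theta>3. 0 < \<Theta>1 \<and> \<Theta>1 < \<Theta>2 \<and> \<Theta>2 < \<Theta>3 \<and> euler_rho \<Theta>1 \<Theta>2 \<Theta>3 = \<rho>"
proof -
  define q where "q = \<rho>\<^sup>2"
  have q: "q > 0" using assms by (simp add: q_def)
  define a where "a = (2 + q) / (1 + q)"
  have 1: "a - 1 = 1 / (1 + q)" and 2: "(2 + q) - a = (2 + q) * q / (1 + q)"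
    using q by (simp_all add: a_def field_simps)
  have "1 < a" "a < 2 + q"
  proof -
    have "0 < 1 / (1 + q)" "0 < (2 + q) * q / (1 + q)" using q by simp_all
    then show "1 < a" "a < 2 + q" using 1 2 by linarith+
  qed
  moreover have "(1 * ((2 + q) - a)) / ((2 + q) * (a - 1)) = q"
    unfolding 1 2 using q by simp
  then have "euler_rho 1 a (2 + q) = \<rho>"
    using assms by (simp add: euler_rho_def q_def)
  ultimately show ?thesis by (intro exI[of _ 1] exI[of _ a] exI[of _ "2 + q"]) simp
qed

end

theory Submission
  imports Defs
begin

text \<open>
  Write $a = 2h$, let $e \in \{1/\rho, -\rho\}$ be the other end of the interval of integration and
  $r$ the remaining nonzero branch point. Then $W(z) = w(z)^2 = z(z-e)(z-r)$ with $er = -1$ and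
  $e + r = -\kappa$, and both actions are $\frac{1}{2\pi}\int \sqrt{(x-a)/(x(x-r)(e-x))}\,dx$
  over the segment between $a$ and $e$, so one argument serves both signs of $h$.

  The obstacle is that the integrand is singular at $e$ and that the end $a$ moves. The
  substitution $x = a\cos^2\theta + e\sin^2\theta$ removes both
  (\<open>action_integral_eq_arc\<close>): the action becomes
  $\frac{1}{\pi}|e-a|\int_0^{\pi/2} \sin^2\theta\,Q(x)^{-1/2}\,d\theta$ with $Q(x) = x(x-r) > 0$,
  and the integrand is now smooth in $a$ and $\theta$, so that one may differentiate under the
  integral as often as desired (\<open>has_field_derivative_arc_integral\<close>).

  Everything else is integration by parts in $\theta$. The exact form
  $d(\sin\theta\cos\theta\,Q^{-1/2})$ shows that the first derivative of the action is, up to a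
  constant factor, the complete elliptic integral
  $P(a) = \int_0^{\pi/2} Q(x)^{-1/2}\,d\theta$ (\<open>period_as_action_derivative\<close>).
  The equation to be proved then reads $4WP'' + 4W'P' + \frac{1}{2}W''P = 0$. It holds because
  this combination of $a$-derivatives of the integrand $Q^{-1/2}$ is itself the
  $\theta$-derivative of a function $\sin\theta\cos\theta\,N\,Q^{-3/2}$, which vanishes at both
  ends (\<open>picard_fuchs_exact_form\<close>).
\<close>

section \<open>Trigonometric parametrisation of a segment\<close>

definition arc_point :: "real \<Rightarrow> real \<Rightarrow> real \<Rightarrow> real" where
  "arc_point a e \<theta> = a * (cos \<theta>)\<^sup>2 + e * (sin \<theta>)\<^sup>2"

lemma arc_point_alt: "arc_point a e \<theta> = e + (a - e) * (cos \<theta>)\<^sup>2"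
  by (simp add: arc_point_def sin_squared_eq algebra_simps)

lemma arc_point_minus_start: "arc_point a e \<theta> - a = (e - a) * (sin \<theta>)\<^sup>2"
  by (simp add: arc_point_def cos_squared_eq algebra_simps)

lemma end_minus_arc_point: "e - arc_point a e \<theta> = (e - a) * (cos \<theta>)\<^sup>2"
  by (simp add: arc_point_alt algebra_simps)

lemma arc_point_in_convex:
  assumes "convex U" "a \<in> U" "e \<in> U"
  shows "arc_point a e \<theta> \<in> U"
  using convexD[OF assms, of "(cos \<theta>)\<^sup>2" "(sin \<theta>)\<^sup>2"]
  by (simp add: arc_point_def mult.commute)

lemma arc_point_image:
  "arc_point a e ` {0..pi/2} = closed_segment a e"
proof
  show "arc_point a e ` {0..pi/2} \<subseteq> closed_segment a e"
    using arc_point_in_convex[OF convex_closed_segment ends_in_segment] by blast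
  show "closed_segment a e \<subseteq> arc_point a e ` {0..pi/2}"
  proof
    fix x assume "x \<in> closed_segment a e"
    then obtain u where u: "0 \<le> u" "u \<le> 1" "x = (1 - u) * a + u * e"
      by (auto simp: closed_segment_def)
    define \<theta> where "\<theta> = arcsin (sqrt u)"
    have s: "sqrt u \<le> 1" "0 \<le> sqrt u" using u by auto
    have 1: "sin \<theta> = sqrt u" unfolding \<theta>_def by (rule sin_arcsin) (use s in linarith)+
    have 2: "\<theta> \<le> pi/2" unfolding \<theta>_def using arcsin_bounded[of "sqrt u"] s by linarith
    have 3: "0 \<le> \<theta>" unfolding \<theta>_def using s by (simp add: arcsin_le_arcsin[of 0, simplified])
    have "arc_point a e \<theta> = x"
      using u by (simp add: arc_point_def cos_squared_eq 1 algebra_simps)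
    then show "x \<in> arc_point a e ` {0..pi/2}" using 2 3 by force
  qed
qed

lemma arc_point_inj:
  assumes "a \<noteq> e"
  shows "inj_on (arc_point a e) {0..pi/2}"
proof (rule inj_onI)
  fix x y assume xy: "x \<in> {0..pi/2}" "y \<in> {0..pi/2}" "arc_point a e x = arc_point a e y"
  then have "(cos x)\<^sup>2 = (cos y)\<^sup>2" using assms by (simp add: arc_point_alt)
  moreover have "0 \<le> cos x" "0 \<le> cos y" using xy by (auto intro!: cos_ge_zero)
  ultimately have "cos x = cos y" by (simp add: power2_eq_iff_nonneg)
  with xy show "x = y" using cos_inj_pi[of x y] by auto
qed

lemma arc_point_has_derivative:
  "(arc_point a e has_field_derivative 2 * (e - a) * sin \<theta> * cos \<theta>) (at \<theta> within S)"
  unfolding arc_point_def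
  by (auto intro!: derivative_eq_intros simp: algebra_simps)

lemma continuous_on_arc_point:
  fixes f g :: "'a::t2_space \<Rightarrow> real"
  assumes "continuous_on S f" "continuous_on S g"
  shows "continuous_on S (\<lambda>x. arc_point (f x) e (g x))"
  unfolding arc_point_def
  by (intro continuous_intros continuous_on_cos continuous_on_sin assms)

section \<open>Integrals along the parametrised segment\<close>

text \<open>
  The weight \<open>c\<close> collects the powers of sine and cosine: each derivative in \<open>a\<close>
  contributes a factor \<open>cos\<^sup>2\<close>, since $\partial x/\partial a = \cos^2\theta$.
\<close>

definition arc_integral :: "(real \<Rightarrow> real) \<Rightarrow> (real \<Rightarrow> real) \<Rightarrow> real \<Rightarrow> real \<Rightarrow> real" where
  "arc_integral c \<phi> e a = integral {0..pi/2} (\<lambda>\<theta>. c \<theta> * \<phi> (arc_point a e \<theta>))"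

lemma continuous_on_arc_integrand:
  fixes c \<phi> :: "real \<Rightarrow> real"
  assumes "convex U" "a \<in> U" "e \<in> U" "continuous_on U \<phi>" "continuous_on {0..pi/2} c"
  shows "continuous_on {0..pi/2} (\<lambda>\<theta>. c \<theta> * \<phi> (arc_point a e \<theta>))"
proof (rule continuous_on_mult[OF assms(5)], rule continuous_on_compose2[OF assms(4)])
  show "continuous_on {0..pi/2} (arc_point a e)"
    by (rule continuous_on_arc_point[OF continuous_on_const continuous_on_id])
  show "arc_point a e ` {0..pi/2} \<subseteq> U"
    using arc_point_in_convex[OF assms(1-3)] by blast
qed

lemma has_integral_arc_integral:
  assumes "convex U" "a \<in> U" "e \<in> U" "continuous_on U \<phi>" "continuous_on {0..pi/2} c"
  shows "((\<lambda>\<theta>. c \<theta> * \<phi> (arc_point a e \<theta>)) has_integral arc_integral c \<phi> e a) {0..pi/2}"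
  unfolding arc_integral_def
  by (intro integrable_integral integrable_continuous_real continuous_on_arc_integrand[OF assms])

text \<open>
  The interval of integration is fixed and the parametrised points stay in the convex set
  \<open>U\<close>, so Leibniz' rule applies however close \<open>a\<close> is to the boundary of \<open>U\<close>.
\<close>

lemma has_field_derivative_arc_integral:
  fixes c \<phi> \<phi>' :: "real \<Rightarrow> real"
  assumes U: "open U" "convex U" and mem: "a \<in> U" "e \<in> U"
    and der: "\<And>x. x \<in> U \<Longrightarrow> (\<phi> has_field_derivative \<phi>' x) (at x)"
    and cont: "continuous_on U \<phi>'" and c: "continuous_on {0..pi/2} c"
  shows "(arc_integral c \<phi> e has_field_derivative
           arc_integral (\<lambda>\<theta>. c \<theta> * (cos \<theta>)\<^sup>2) \<phi>' e a) (at a)"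
proof -
  have in_U: "arc_point x e \<theta> \<in> U" if "x \<in> U" for x \<theta>
    using arc_point_in_convex U(2) that mem(2) by blast
  have cont0: "continuous_on U \<phi>"
    using der by (meson DERIV_continuous continuous_at_imp_continuous_on)
  have d: "((\<lambda>x. c \<theta> * \<phi> (arc_point x e \<theta>)) has_field_derivative
        c \<theta> * (cos \<theta>)\<^sup>2 * \<phi>' (arc_point x e \<theta>)) (at x within U)" if "x \<in> U" for x \<theta>
  proof -
    have "((\<lambda>x. arc_point x e \<theta>) has_field_derivative (cos \<theta>)\<^sup>2) (at x within U)"
      unfolding arc_point_def by (rule derivative_eq_intros refl)+ simp
    from DERIV_cmult[OF DERIV_chain2[OF der[OF in_U[OF that]] this], of "c \<theta>"]
    show ?thesis by (simp only: mult_ac)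
  qed
  have i: "(\<lambda>\<theta>. c \<theta> * \<phi> (arc_point x e \<theta>)) integrable_on {0..pi/2}" if "x \<in> U" for x
    by (intro integrable_continuous_real continuous_on_arc_integrand[OF U(2) that mem(2) cont0 c])
  have cc: "continuous_on (U \<times> {0..pi/2})
      (\<lambda>(x, \<theta>). c \<theta> * (cos \<theta>)\<^sup>2 * \<phi>' (arc_point x e \<theta>))"
    unfolding split_beta
  proof (rule continuous_on_mult)
    have "continuous_on (U \<times> {0..pi/2}) (\<lambda>p. c (snd p))"
      by (rule continuous_on_compose2[OF c continuous_on_snd[OF continuous_on_id]]) auto
    then show "continuous_on (U \<times> {0..pi/2}) (\<lambda>p. c (snd p) * (cos (snd p))\<^sup>2)"
      by (intro continuous_intros)
    have "continuous_on (U \<times> {0..pi/2}) (\<lambda>p. arc_point (fst p) e (snd p))"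
      by (rule continuous_on_arc_point[OF continuous_on_fst continuous_on_snd]) (rule continuous_on_id)+
    then show "continuous_on (U \<times> {0..pi/2}) (\<lambda>p. \<phi>' (arc_point (fst p) e (snd p)))"
      by (rule continuous_on_compose2[OF cont]) (use in_U in auto)
  qed
  have "((\<lambda>a. integral {0..pi/2} (\<lambda>\<theta>. c \<theta> * \<phi> (arc_point a e \<theta>))) has_field_derivative
           integral {0..pi/2} (\<lambda>\<theta>. c \<theta> * (cos \<theta>)\<^sup>2 * \<phi>' (arc_point a e \<theta>))) (at a within U)"
    using leibniz_rule_field_derivative[OF d i[folded cbox_interval] cc[folded cbox_interval] mem(1) U(2)]
    by (simp only: cbox_interval)
  then show ?thesis by (simp only: at_within_open[OF mem(1) U(1)] arc_integral_def[abs_def])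
qed

section \<open>The inverse square root of the quadratic factor\<close>

text \<open>
  The function $Q^{-1/2}$ with $Q(x) = x(x-r)$, followed by its first two derivatives.
\<close>

definition inv_sqrt_quad :: "real \<Rightarrow> real \<Rightarrow> real" where
  "inv_sqrt_quad r x = 1 / sqrt (x * (x - r))"

definition inv_sqrt_quad_deriv1 :: "real \<Rightarrow> real \<Rightarrow> real" where
  "inv_sqrt_quad_deriv1 r x = - (2 * x - r) / (2 * sqrt (x * (x - r)) ^ 3)"

definition inv_sqrt_quad_deriv2 :: "real \<Rightarrow> real \<Rightarrow> real" where
  "inv_sqrt_quad_deriv2 r x = (3 * (2 * x - r)\<^sup>2 - 4 * (x * (x - r))) / (4 * sqrt (x * (x - r)) ^ 5)"

lemma self_product_pos:
  fixes e r :: real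
  assumes "e * r < 0"
  shows "0 < e * e"
  using assms by (cases "e = 0") (auto simp: zero_less_mult_iff)

text \<open>
  On the side of $0$ where \<open>e\<close> lies, $x$ and $x - r$ have the same sign because \<open>r\<close> lies on
  the other side.
\<close>

lemma quadratic_pos:
  fixes e r x :: real
  assumes "e * r < 0" "0 < x * e"
  shows "0 < x * (x - r)"
  using assms by (auto simp: zero_less_mult_iff mult_less_0_iff)

lemma sqrt_quadratic_has_derivative:
  assumes "(g has_field_derivative g') (at x within S)" "0 < g x * (g x - r)"
  shows "((\<lambda>x. sqrt (g x * (g x - r))) has_field_derivative
    (2 * g x - r) * g' / (2 * sqrt (g x * (g x - r)))) (at x within S)"
proof -
  have "((\<lambda>x. g x * (g x - r)) has_field_derivative (2 * g x - r) * g') (at x within S)"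
    by (rule DERIV_cong, rule DERIV_mult[OF assms(1) DERIV_diff[OF assms(1) DERIV_const[of r]]])
       (simp add: algebra_simps)
  note chain = this
  have "inverse s / 2 * D = D / (2 * s)" for s D :: real by (simp add: field_simps)
  then show ?thesis
    by (intro DERIV_cong[OF DERIV_chain2[where f = sqrt, OF DERIV_real_sqrt[OF assms(2)] chain]])
qed

lemma inv_sqrt_quad_has_derivative:
  assumes "0 < x * (x - r)"
  shows "(inv_sqrt_quad r has_field_derivative inv_sqrt_quad_deriv1 r x) (at x)"
proof -
  define q where "q = (\<lambda>x. sqrt (x * (x - r)))"
  have q: "0 < q x" using assms by (simp add: q_def del: real_sqrt_mult)
  have d: "(q has_field_derivative (2 * x - r) / (2 * q x)) (at x)"
    using sqrt_quadratic_has_derivative[OF DERIV_ident assms] by (simp add: q_def)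
  have "((\<lambda>x. 1 / q x) has_field_derivative - ((2 * x - r) / (2 * q x)) / (q x)\<^sup>2) (at x)"
    by (rule d derivative_eq_intros refl)+ (use q in \<open>auto simp: power2_eq_square\<close>)
  moreover have "- ((2 * x - r) / (2 * q x)) / (q x)\<^sup>2 = - (2 * x - r) / (2 * q x ^ 3)"
    by (simp add: power2_eq_square power3_eq_cube minus_divide_left mult.assoc)
  ultimately show ?thesis by (simp only: inv_sqrt_quad_def[abs_def] inv_sqrt_quad_deriv1_def q_def)
qed

lemma inv_sqrt_quad_deriv1_has_derivative:
  assumes "0 < x * (x - r)"
  shows "(inv_sqrt_quad_deriv1 r has_field_derivative inv_sqrt_quad_deriv2 r x) (at x)"
proof -
  define q where "q = (\<lambda>x. sqrt (x * (x - r)))"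
  have q: "0 < q x" using assms by (simp add: q_def del: real_sqrt_mult)
  have q2: "x * (x - r) = (q x)\<^sup>2" using assms by (simp add: q_def del: real_sqrt_mult)
  have d: "(q has_field_derivative (2 * x - r) / (2 * q x)) (at x)"
    using sqrt_quadratic_has_derivative[OF DERIV_ident assms] by (simp add: q_def)
  have "((\<lambda>x. - (2 * x - r) / (2 * q x ^ 3)) has_field_derivative
      (3 * (2 * x - r)\<^sup>2 - 4 * (q x)\<^sup>2) / (4 * q x ^ 5)) (at x)"
    by (rule d derivative_eq_intros refl)+
       (use q in \<open>auto simp: field_simps eval_nat_numeral\<close>)
  then show ?thesis unfolding q2[symmetric] by (simp only: inv_sqrt_quad_deriv1_def[abs_def] inv_sqrt_quad_deriv2_def q_def)
qed

lemma continuous_on_inv_sqrt_quad: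
  assumes "e * r < 0"
  shows "continuous_on {x. 0 < x * e} (inv_sqrt_quad r)" "continuous_on {x. 0 < x * e} (inv_sqrt_quad_deriv1 r)"
    "continuous_on {x. 0 < x * e} (inv_sqrt_quad_deriv2 r)"
  unfolding inv_sqrt_quad_def[abs_def] inv_sqrt_quad_deriv1_def[abs_def] inv_sqrt_quad_deriv2_def[abs_def]
  by (intro continuous_intros; use quadratic_pos[OF assms] in fastforce)+

lemma convex_open_half_line: "open {x. 0 < x * (e::real)}" "convex {x. 0 < x * (e::real)}"
proof -
  show "open {x. 0 < x * (e::real)}" by (intro open_Collect_less continuous_intros)
  have "{x. 0 < x * e} = (if e > 0 then {0<..} else if e < 0 then {..<0} else {})"
    by (auto simp: zero_less_mult_iff)
  then show "convex {x. 0 < x * e}" by auto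
qed

section \<open>Regularising the action integral\<close>

text \<open>
  In the new variable $(x-a)/(e-x) = \tan^2\theta$ and
  $|dx/d\theta| = 2|e-a|\sin\theta\cos\theta$, so the pole of the tangent cancels. The
  absolutely integrable form of the substitution rule is needed because the integrand on the left
  is unbounded near \<open>e\<close>.
\<close>

lemma action_integral_eq_arc:
  fixes a e r :: real
  assumes ae: "0 < a * e" and er: "e * r < 0" and ne: "a \<noteq> e"
  shows "integral (closed_segment a e) (\<lambda>x. sqrt ((x - a) / (x * (x - r) * (e - x)))) =
         2 * \<bar>e - a\<bar> * arc_integral (\<lambda>\<theta>. (sin \<theta>)\<^sup>2) (inv_sqrt_quad r) e a"
proof -
  let ?f = "\<lambda>x. sqrt ((x - a) / (x * (x - r) * (e - x)))"
  let ?g' = "\<lambda>\<theta>. 2 * (e - a) * sin \<theta> * cos \<theta>"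
  let ?F = "\<lambda>\<theta>. 2 * \<bar>e - a\<bar> * ((sin \<theta>)\<^sup>2 * inv_sqrt_quad r (arc_point a e \<theta>))"
  have eU: "e \<in> {x. 0 < x * e}" using self_product_pos[OF er] by simp
  have in_U: "arc_point a e \<theta> \<in> {x. 0 < x * e}" for \<theta>
    using arc_point_in_convex[OF convex_open_half_line(2)] ae eU by blast
  have cont: "continuous_on {0..pi/2} ?F"
    by (intro continuous_intros continuous_on_arc_integrand[OF convex_open_half_line(2) _ _ continuous_on_inv_sqrt_quad(1)[OF er]])
       (use ae eU in auto)
  \<comment> \<open>At the excluded endpoint the left-hand side is \<open>0\<close>, as \<open>cos (pi/2) = 0\<close>, whereas the
    right-hand side is its nonzero continuous extension; a single point does not affect the
    integral.\<close>
  have eq: "\<bar>?g' \<theta>\<bar> * ?f (arc_point a e \<theta>) = ?F \<theta>" if "\<theta> \<in> {0..pi/2} - {pi/2}" for \<theta>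
  proof -
    let ?x = "arc_point a e \<theta>"
    have c: "0 < cos \<theta>" using that by (intro cos_gt_zero_pi) auto
    have s: "0 \<le> sin \<theta>" using that by (intro sin_ge_zero) auto
    have "(?x - a) / (?x * (?x - r) * (e - ?x)) = (sin \<theta> / cos \<theta>)\<^sup>2 / (?x * (?x - r))"
      using c ne by (simp add: arc_point_minus_start end_minus_arc_point power_divide)
    then have "?f ?x = (sin \<theta> / cos \<theta>) * inv_sqrt_quad r ?x"
      using c s by (simp add: real_sqrt_divide inv_sqrt_quad_def)
    moreover have "\<bar>?g' \<theta>\<bar> = \<bar>e - a\<bar> * (2 * sin \<theta> * cos \<theta>)"
      using c s abs_mult[of "e - a" "2 * sin \<theta> * cos \<theta>"] by (simp add: mult_ac)
    ultimately show ?thesis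
      using c by (simp add: power2_eq_square)
  qed
  have "(\<lambda>\<theta>. \<bar>?g' \<theta>\<bar> * ?f (arc_point a e \<theta>)) absolutely_integrable_on {0..pi/2}"
    by (rule absolutely_integrable_spike[OF
          absolutely_integrable_continuous_real[OF cont], of "{pi/2}"])
       (use eq in auto)
  moreover have "(\<lambda>\<theta>. \<bar>?g' \<theta>\<bar> * ?f (arc_point a e \<theta>)) absolutely_integrable_on {0..pi/2} \<and>
      integral {0..pi/2} (\<lambda>\<theta>. \<bar>?g' \<theta>\<bar> * ?f (arc_point a e \<theta>)) = b \<longleftrightarrow>
      ?f absolutely_integrable_on (arc_point a e ` {0..pi/2}) \<and>
      integral (arc_point a e ` {0..pi/2}) ?f = b" for b
    by (rule has_absolute_integral_change_of_variables_1'[OF _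
          arc_point_has_derivative arc_point_inj[OF ne]]) simp
  ultimately have "integral (arc_point a e ` {0..pi/2}) ?f
      = integral {0..pi/2} (\<lambda>\<theta>. \<bar>?g' \<theta>\<bar> * ?f (arc_point a e \<theta>))"
    by blast
  then have "integral (closed_segment a e) ?f
      = integral {0..pi/2} (\<lambda>\<theta>. \<bar>?g' \<theta>\<bar> * ?f (arc_point a e \<theta>))"
    by (simp only: arc_point_image)
  also have "\<dots> = integral {0..pi/2} ?F"
    by (rule integral_spike[of "{pi/2}"]) (use eq in auto)
  finally show ?thesis by (simp add: arc_integral_def)
qed

section \<open>The Picard-Fuchs equation of the period\<close>

text \<open>
  This is the coefficient comparison that determines \<open>N\<close>. With $C = \cos^2\theta$ and \<open>M\<close>
  standing for $N'(\theta)/(\sin\theta\cos\theta)$, the left-hand side is $Q^{5/2}$ times the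
  $\theta$-derivative of $\sin\theta\cos\theta\,N\,Q^{-3/2}$, and the right-hand side is
  $Q^{5/2}$ times $4W\partial_a^2 + 4W'\partial_a + \frac{1}{2}W''$ applied to $Q^{-1/2}$. Setting
  $C = 0$ and $C = 1$ gives the values of \<open>N\<close> there, and the remaining coefficient of the
  quadratic polynomial \<open>N\<close> in \<open>C\<close> follows by comparison.
\<close>

lemma picard_fuchs_polynomial_identity:
  fixes a e r C :: real
  defines "x \<equiv> e + (a - e) * C"
  defines "Q \<equiv> x * (x - r)"
  defines "N \<equiv> (a - e) * C * (a * x + (a - r) * (x - r)) - (3 * a - e - r) * Q"
  defines "M \<equiv> 2 * (e - a) * ((a * x + (a - r) * (x - r)) + (a - e) * C * (2 * a - r)
        - (3 * a - e - r) * (2 * x - r))"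
  shows "((2 * C - 1) * N + C * (1 - C) * M) * Q - 3 * (C * (1 - C)) * N * (2 * x - r) * (e - a)
    = a * (a - e) * (a - r) * C\<^sup>2 * (3 * (2 * x - r)\<^sup>2 - 4 * Q)
     - 2 * (3 * a\<^sup>2 - 2 * (e + r) * a + e * r) * C * (2 * x - r) * Q
     + (3 * a - (e + r)) * Q\<^sup>2"
  unfolding M_def N_def Q_def x_def by (simp add: algebra_simps power2_eq_square)

text \<open>
  In the variable $x$ the corresponding fact is that $4W\partial_a^2 + 4W'\partial_a +
  \frac{1}{2}W''$, with coefficients taken at $a$, maps $((x-a)W(x))^{-1/2}$ to
  $-2\,\partial_x\bigl(W(x)^{1/2}(x-a)^{-3/2}\bigr)$. That primitive blows up at the end $x = a$;
  differentiating at fixed $\theta$ instead of fixed $x$ replaces it by one that is smooth and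
  vanishes at both ends.
\<close>

lemma picard_fuchs_exact_form:
  fixes a e r \<theta> :: real
  defines "x \<equiv> arc_point a e \<theta>"
  assumes "0 < x * (x - r)"
  shows "((\<lambda>\<theta>. sin \<theta> * cos \<theta> *
      ((a - e) * (cos \<theta>)\<^sup>2 * (a * arc_point a e \<theta> + (a - r) * (arc_point a e \<theta> - r))
        - (3 * a - e - r) * (arc_point a e \<theta> * (arc_point a e \<theta> - r)))
      / sqrt (arc_point a e \<theta> * (arc_point a e \<theta> - r)) ^ 3) has_field_derivative
     4 * (a * (a - e) * (a - r)) * ((cos \<theta>) ^ 4 * inv_sqrt_quad_deriv2 r x)
     + 4 * (3 * a\<^sup>2 - 2 * (e + r) * a + e * r) * ((cos \<theta>)\<^sup>2 * inv_sqrt_quad_deriv1 r x)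
     + (3 * a - (e + r)) * inv_sqrt_quad r x) (at \<theta> within S)"
proof -
  define C where "C = (cos \<theta>)\<^sup>2"
  define q where "q = (\<lambda>\<theta>. sqrt (arc_point a e \<theta> * (arc_point a e \<theta> - r)))"
  define L where "L = (\<lambda>x. a * x + (a - r) * (x - r))"
  define N where "N = (\<lambda>\<theta>. (a - e) * (cos \<theta>)\<^sup>2 * L (arc_point a e \<theta>)
        - (3 * a - e - r) * (arc_point a e \<theta> * (arc_point a e \<theta> - r)))"
  define M where "M = 2 * (e - a) * (L x + (a - e) * C * (2 * a - r) - (3 * a - e - r) * (2 * x - r))"
  have xC: "x = e + (a - e) * C" by (simp add: x_def C_def arc_point_alt)
  have s2: "(sin \<theta>)\<^sup>2 = 1 - C" by (simp add: C_def sin_squared_eq)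
  have q: "0 < q \<theta>" using assms(2) by (simp add: q_def x_def del: real_sqrt_mult)
  have q2: "(q \<theta>)\<^sup>2 = x * (x - r)"
    using assms(2) by (simp add: q_def x_def del: real_sqrt_mult)
  have dx: "(arc_point a e has_field_derivative 2 * (e - a) * sin \<theta> * cos \<theta>) (at \<theta> within S)"
    by (rule arc_point_has_derivative)
  have dq: "(q has_field_derivative (2 * x - r) * (2 * (e - a) * sin \<theta> * cos \<theta>) / (2 * q \<theta>))
      (at \<theta> within S)"
    using sqrt_quadratic_has_derivative[OF dx, of r] assms(2) by (simp add: q_def x_def)
  have dN: "(N has_field_derivative sin \<theta> * cos \<theta> * M) (at \<theta> within S)"
    unfolding N_def L_def M_def x_def C_def
    by (rule dx derivative_eq_intros refl)+ (simp add: algebra_simps power2_eq_square)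
  have "((\<lambda>\<theta>. sin \<theta> * cos \<theta> * N \<theta> / q \<theta> ^ 3) has_field_derivative
      (((2 * C - 1) * N \<theta> + C * (1 - C) * M) * (q \<theta>)\<^sup>2
        - 3 * (C * (1 - C)) * N \<theta> * (2 * x - r) * (e - a)) / q \<theta> ^ 5) (at \<theta> within S)"
  proof -
    have sc: "((\<lambda>\<theta>. sin \<theta> * cos \<theta>) has_field_derivative 2 * C - 1) (at \<theta> within S)"
      by (rule derivative_eq_intros refl)+ (use s2 in \<open>simp add: C_def power2_eq_square\<close>)
    have cs: "C * (1 - C) = (sin \<theta> * cos \<theta>)\<^sup>2"
      by (simp add: power_mult_distrib s2 C_def[symmetric])
    show ?thesis unfolding cs
      by (rule sc dN dq derivative_eq_intros refl)+
         (use q in \<open>auto simp: field_simps eval_nat_numeral\<close>)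
  qed
  moreover have "(((2 * C - 1) * N \<theta> + C * (1 - C) * M) * (q \<theta>)\<^sup>2
        - 3 * (C * (1 - C)) * N \<theta> * (2 * x - r) * (e - a))
      = a * (a - e) * (a - r) * C\<^sup>2 * (3 * (2 * x - r)\<^sup>2 - 4 * (x * (x - r)))
       - 2 * (3 * a\<^sup>2 - 2 * (e + r) * a + e * r) * C * (2 * x - r) * (q \<theta>)\<^sup>2
       + (3 * a - (e + r)) * q \<theta> ^ 4"
  proof -
    have N: "N \<theta> = (a - e) * C * L x - (3 * a - e - r) * (x * (x - r))"
      by (simp add: N_def C_def x_def)
    have q4: "q \<theta> ^ 4 = (x * (x - r))\<^sup>2" by (simp flip: q2)
    show ?thesis
      unfolding N q4 q2 M_def L_def xC by (rule picard_fuchs_polynomial_identity)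
  qed
  moreover have "(a * (a - e) * (a - r) * C\<^sup>2 * (3 * (2 * x - r)\<^sup>2 - 4 * (x * (x - r)))
       - 2 * (3 * a\<^sup>2 - 2 * (e + r) * a + e * r) * C * (2 * x - r) * (q \<theta>)\<^sup>2
       + (3 * a - (e + r)) * q \<theta> ^ 4) / q \<theta> ^ 5
     = 4 * (a * (a - e) * (a - r)) * ((cos \<theta>) ^ 4 * inv_sqrt_quad_deriv2 r x)
     + 4 * (3 * a\<^sup>2 - 2 * (e + r) * a + e * r) * ((cos \<theta>)\<^sup>2 * inv_sqrt_quad_deriv1 r x)
     + (3 * a - (e + r)) * inv_sqrt_quad r x"
  proof -
    have qx: "sqrt (x * (x - r)) = q \<theta>" by (simp add: q_def x_def)
    have c4: "(cos \<theta>) ^ 4 = C\<^sup>2" by (simp add: C_def)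
    have "(U * K\<^sup>2 * V - 2 * W * K * Y * (q \<theta>)\<^sup>2 + Z * q \<theta> ^ 4) / q \<theta> ^ 5
        = 4 * U * (K\<^sup>2 * (V / (4 * q \<theta> ^ 5))) + 4 * W * (K * (- Y / (2 * q \<theta> ^ 3)))
          + Z * (1 / q \<theta>)" for U V W K Y Z :: real
      using q by (simp add: field_simps eval_nat_numeral)
    then show ?thesis
      unfolding inv_sqrt_quad_def inv_sqrt_quad_deriv1_def inv_sqrt_quad_deriv2_def qx c4 C_def[symmetric] by blast
  qed
  ultimately show ?thesis
    unfolding N_def L_def q_def x_def by simp
qed

text \<open>
  The only form in which integration by parts is used below.
\<close>

lemma has_integral_derivative_vanishing_ends:
  fixes G :: "real \<Rightarrow> real"
  assumes "\<And>\<theta>. (G has_field_derivative g \<theta>) (at \<theta> within {0..pi/2})" "G 0 = 0" "G (pi/2) = 0"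
  shows "(g has_integral 0) {0..pi/2}"
  using fundamental_theorem_of_calculus[of 0 "pi/2" G g] assms
  by (simp add: has_real_derivative_iff_has_vector_derivative)

lemma arc_integral_derivatives:
  fixes a e r :: real
  assumes er: "e * r < 0" and a: "0 < a * e" and c: "continuous_on {0..pi/2} c"
  shows "(arc_integral c (inv_sqrt_quad r) e has_field_derivative
           arc_integral (\<lambda>\<theta>. c \<theta> * (cos \<theta>)\<^sup>2) (inv_sqrt_quad_deriv1 r) e a) (at a)"
    and "(arc_integral c (inv_sqrt_quad_deriv1 r) e has_field_derivative
           arc_integral (\<lambda>\<theta>. c \<theta> * (cos \<theta>)\<^sup>2) (inv_sqrt_quad_deriv2 r) e a) (at a)"
proof -
  have "0 < e * e" by (rule self_product_pos[OF er])
  then show "(arc_integral c (inv_sqrt_quad r) e has_field_derivative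
           arc_integral (\<lambda>\<theta>. c \<theta> * (cos \<theta>)\<^sup>2) (inv_sqrt_quad_deriv1 r) e a) (at a)"
    and "(arc_integral c (inv_sqrt_quad_deriv1 r) e has_field_derivative
           arc_integral (\<lambda>\<theta>. c \<theta> * (cos \<theta>)\<^sup>2) (inv_sqrt_quad_deriv2 r) e a) (at a)"
    using a
    by (intro has_field_derivative_arc_integral[OF convex_open_half_line, of a e] c
        continuous_on_inv_sqrt_quad[OF er] inv_sqrt_quad_has_derivative inv_sqrt_quad_deriv1_has_derivative;
        use quadratic_pos[OF er] in simp)+
qed

lemma has_integral_arc_inv_sqrt_quad:
  fixes a e r :: real
  assumes er: "e * r < 0" and a: "0 < a * e" and c: "continuous_on {0..pi/2} c"
  shows "((\<lambda>\<theta>. c \<theta> * inv_sqrt_quad r (arc_point a e \<theta>)) has_integral arc_integral c (inv_sqrt_quad r) e a) {0..pi/2}"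
    and "((\<lambda>\<theta>. c \<theta> * inv_sqrt_quad_deriv1 r (arc_point a e \<theta>)) has_integral arc_integral c (inv_sqrt_quad_deriv1 r) e a) {0..pi/2}"
    and "((\<lambda>\<theta>. c \<theta> * inv_sqrt_quad_deriv2 r (arc_point a e \<theta>)) has_integral arc_integral c (inv_sqrt_quad_deriv2 r) e a) {0..pi/2}"
proof -
  have "0 < e * e" by (rule self_product_pos[OF er])
  then have m: "a \<in> {x. 0 < x * e}" "e \<in> {x. 0 < x * e}" using a by auto
  note * = has_integral_arc_integral[OF convex_open_half_line(2) m _ c]
  show "((\<lambda>\<theta>. c \<theta> * inv_sqrt_quad r (arc_point a e \<theta>)) has_integral arc_integral c (inv_sqrt_quad r) e a) {0..pi/2}"
    and "((\<lambda>\<theta>. c \<theta> * inv_sqrt_quad_deriv1 r (arc_point a e \<theta>)) has_integral arc_integral c (inv_sqrt_quad_deriv1 r) e a) {0..pi/2}"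
    and "((\<lambda>\<theta>. c \<theta> * inv_sqrt_quad_deriv2 r (arc_point a e \<theta>)) has_integral arc_integral c (inv_sqrt_quad_deriv2 r) e a) {0..pi/2}"
    by (intro * continuous_on_inv_sqrt_quad[OF er])+
qed

lemma arc_point_quadratic_pos:
  fixes a e r :: real
  assumes er: "e * r < 0" and a: "0 < a * e"
  shows "0 < arc_point a e \<theta> * (arc_point a e \<theta> - r)"
proof -
  have "0 < e * e" by (rule self_product_pos[OF er])
  then have "arc_point a e \<theta> \<in> {x. 0 < x * e}"
    using a by (intro arc_point_in_convex convex_open_half_line) auto
  then show ?thesis using quadratic_pos[OF er] by simp
qed

text \<open>
  Formally, differentiating $\sqrt{x-a}$ under the integral turns the action integrand into
  $-\frac{1}{2}$ times the integrand of the period. The regularised integral gives this only up to an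
  exact term: with $s = \sin^2\theta$ and $\phi = Q^{-1/2}$ its derivative is
  $\int(-2s\phi + 2(e-a)s(1-s)\phi')$, and adding $\int\phi$ gives the integral of
  $\frac{d}{d\theta}(\sin\theta\cos\theta\,\phi(x))$, which is zero.
\<close>

lemma period_as_action_derivative:
  fixes a e r :: real
  assumes er: "e * r < 0" and a: "0 < a * e"
  shows "((\<lambda>a. 2 * (e - a) * arc_integral (\<lambda>\<theta>. (sin \<theta>)\<^sup>2) (inv_sqrt_quad r) e a) has_field_derivative
           - arc_integral (\<lambda>_. 1) (inv_sqrt_quad r) e a) (at a)"
proof -
  let ?S = "arc_integral (\<lambda>\<theta>. (sin \<theta>)\<^sup>2) (inv_sqrt_quad r) e a"
  let ?SC = "arc_integral (\<lambda>\<theta>. (sin \<theta>)\<^sup>2 * (cos \<theta>)\<^sup>2) (inv_sqrt_quad_deriv1 r) e a"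
  let ?P = "arc_integral (\<lambda>_. 1) (inv_sqrt_quad r) e a"
  have "((\<lambda>\<theta>. sin \<theta> * cos \<theta> * inv_sqrt_quad r (arc_point a e \<theta>)) has_field_derivative
      1 * inv_sqrt_quad r (arc_point a e \<theta>) - 2 * ((sin \<theta>)\<^sup>2 * inv_sqrt_quad r (arc_point a e \<theta>))
      + 2 * (e - a) * ((sin \<theta>)\<^sup>2 * (cos \<theta>)\<^sup>2 * inv_sqrt_quad_deriv1 r (arc_point a e \<theta>))) (at \<theta> within {0..pi/2})" for \<theta>
  proof -
    note d = DERIV_chain2[where g = "arc_point a e",
        OF inv_sqrt_quad_has_derivative[OF arc_point_quadratic_pos[OF er a]]
        arc_point_has_derivative, of \<theta> "{0..pi/2}"]
    have sc: "((\<lambda>\<theta>. sin \<theta> * cos \<theta>) has_field_derivative 1 - 2 * (sin \<theta>)\<^sup>2) (at \<theta> within {0..pi/2})"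
      by (rule derivative_eq_intros refl)+ (use cos_squared_eq[of \<theta>] in \<open>simp add: power2_eq_square\<close>)
    show ?thesis
      by (rule DERIV_cong[OF DERIV_mult[OF sc d]]) (simp add: algebra_simps power2_eq_square)
  qed
  then have "((\<lambda>\<theta>. 1 * inv_sqrt_quad r (arc_point a e \<theta>) - 2 * ((sin \<theta>)\<^sup>2 * inv_sqrt_quad r (arc_point a e \<theta>))
      + 2 * (e - a) * ((sin \<theta>)\<^sup>2 * (cos \<theta>)\<^sup>2 * inv_sqrt_quad_deriv1 r (arc_point a e \<theta>))) has_integral 0) {0..pi/2}"
    by (rule has_integral_derivative_vanishing_ends) auto
  moreover have "((\<lambda>\<theta>. 1 * inv_sqrt_quad r (arc_point a e \<theta>) - 2 * ((sin \<theta>)\<^sup>2 * inv_sqrt_quad r (arc_point a e \<theta>))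
      + 2 * (e - a) * ((sin \<theta>)\<^sup>2 * (cos \<theta>)\<^sup>2 * inv_sqrt_quad_deriv1 r (arc_point a e \<theta>))) has_integral
      ?P - 2 * ?S + 2 * (e - a) * ?SC) {0..pi/2}"
    by (intro has_integral_add has_integral_diff has_integral_mult_right
        has_integral_arc_inv_sqrt_quad[OF er a] continuous_intros)
  ultimately have "?P - 2 * ?S + 2 * (e - a) * ?SC = 0"
    by (rule has_integral_unique[symmetric])
  then have eq: "- 2 * ?S + ?SC * (2 * (e - a)) = - ?P" by (simp add: algebra_simps)
  have lin: "((\<lambda>a. 2 * (e - a)) has_field_derivative - 2) (at a)"
    by (rule derivative_eq_intros refl | simp)+
  have "continuous_on {0..pi/2} (\<lambda>\<theta>::real. (sin \<theta>)\<^sup>2)" by (intro continuous_intros)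
  from DERIV_mult[OF lin arc_integral_derivatives(1)[OF er a this]]
  show ?thesis unfolding eq .
qed

lemma period_picard_fuchs:
  fixes a e r :: real
  assumes er: "e * r < 0" and a: "0 < a * e"
  shows "4 * (a * (a - e) * (a - r)) * arc_integral (\<lambda>\<theta>. (cos \<theta>) ^ 4) (inv_sqrt_quad_deriv2 r) e a
     + 4 * (3 * a\<^sup>2 - 2 * (e + r) * a + e * r) * arc_integral (\<lambda>\<theta>. (cos \<theta>)\<^sup>2) (inv_sqrt_quad_deriv1 r) e a
     + (3 * a - (e + r)) * arc_integral (\<lambda>_. 1) (inv_sqrt_quad r) e a = 0" (is "?l = 0")
proof -
  let ?k = "\<lambda>\<theta>. 4 * (a * (a - e) * (a - r)) * ((cos \<theta>) ^ 4 * inv_sqrt_quad_deriv2 r (arc_point a e \<theta>))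
     + 4 * (3 * a\<^sup>2 - 2 * (e + r) * a + e * r) * ((cos \<theta>)\<^sup>2 * inv_sqrt_quad_deriv1 r (arc_point a e \<theta>))
     + (3 * a - (e + r)) * (1 * inv_sqrt_quad r (arc_point a e \<theta>))"
  have "(?k has_integral ?l) {0..pi/2}"
    by (intro has_integral_add has_integral_mult_right
        has_integral_arc_inv_sqrt_quad[OF er a] continuous_intros)
  moreover have "(?k has_integral 0) {0..pi/2}"
    unfolding mult_1_left
    by (rule has_integral_derivative_vanishing_ends[OF
          picard_fuchs_exact_form[OF arc_point_quadratic_pos[OF er a]]]) simp_all
  ultimately show ?thesis by (rule has_integral_unique)
qed

section \<open>The Picard-Fuchs equation of the action\<close>

text \<open>
  The derivatives must be known on a whole neighbourhood, since the iterated \<open>deriv\<close> at a point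
  depends on nearby values.
\<close>

lemma iterated_deriv_on_open:
  fixes f :: "real \<Rightarrow> real"
  assumes S: "open S" "x \<in> S"
    and d1: "\<And>y. y \<in> S \<Longrightarrow> (f has_field_derivative f1 y) (at y)"
    and d2: "\<And>y. y \<in> S \<Longrightarrow> (f1 has_field_derivative f2 y) (at y)"
    and d3: "\<And>y. y \<in> S \<Longrightarrow> (f2 has_field_derivative f3 y) (at y)"
  shows "(\<forall>k<3. (deriv ^^ k) f differentiable (at x)) \<and>
    deriv f x = f1 x \<and> (deriv ^^ 2) f x = f2 x \<and> (deriv ^^ 3) f x = f3 x"
proof -
  have step: "(deriv g has_field_derivative g2 y) (at y)"
    if "y \<in> S" "\<And>y. y \<in> S \<Longrightarrow> (g has_field_derivative g1 y) (at y)"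
      "\<And>y. y \<in> S \<Longrightarrow> (g1 has_field_derivative g2 y) (at y)" for g g1 g2 :: "real \<Rightarrow> real" and y
    using that(3)[OF that(1)] S(1) that(1)
    by (rule has_field_derivative_transform_within_open) (simp add: DERIV_imp_deriv[OF that(2)])
  have e1: "(deriv f has_field_derivative f2 y) (at y)" if "y \<in> S" for y
    using step[OF that d1 d2] .
  have e2: "(deriv (deriv f) has_field_derivative f3 y) (at y)" if "y \<in> S" for y
    using step[OF that e1 d3] .
  have "(deriv ^^ k) f differentiable (at x)" if "k < 3" for k
  proof -
    from that have "k = 0 \<or> k = 1 \<or> k = 2" by auto
    then show ?thesis
      using d1[OF S(2)] e1[OF S(2)] e2[OF S(2)]
      by (auto simp: eval_nat_numeral real_differentiable_def)
  qed
  then show ?thesis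
    using d1[OF S(2)] e1[OF S(2)] e2[OF S(2)] by (auto simp: eval_nat_numeral DERIV_imp_deriv)
qed

text \<open>
  The two conditions on \<open>h\<close> say that $2h/e$ lies strictly between $0$ and $1$, whatever the sign
  of \<open>e\<close>; that sign enters the derivatives of the action only as a common constant factor.
\<close>

lemma action_picard_fuchs:
  fixes e r h :: real and I :: "real \<Rightarrow> real"
  assumes er: "e * r < 0"
    and I: "\<And>h. 0 < 2 * h * e \<Longrightarrow> 2 * h * e < e\<^sup>2 \<Longrightarrow> I h = 1 / (2 * pi) *
      integral (closed_segment (2 * h) e) (\<lambda>x. sqrt ((x - 2 * h) / (x * (x - r) * (e - x))))"
    and h: "0 < 2 * h * e" "2 * h * e < e\<^sup>2"
  shows "(\<forall>k<3. (deriv ^^ k) I differentiable (at h)) \<and>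
         2 * h * (2 * h - e) * (2 * h - r) * (deriv ^^ 3) I h
           + 2 * (3 * (2 * h)\<^sup>2 - 2 * (e + r) * (2 * h) + e * r) * (deriv ^^ 2) I h
           + (3 * (2 * h) - (e + r)) * deriv I h = 0"
proof -
  define S where "S = {h. 0 < 2 * h * e \<and> 2 * h * e < e\<^sup>2}"
  define P0 where "P0 = arc_integral (\<lambda>_. 1) (inv_sqrt_quad r) e"
  define P1 where "P1 = arc_integral (\<lambda>\<theta>. (cos \<theta>)\<^sup>2) (inv_sqrt_quad_deriv1 r) e"
  define P2 where "P2 = arc_integral (\<lambda>\<theta>. (cos \<theta>) ^ 4) (inv_sqrt_quad_deriv2 r) e"
  have "open S"
    unfolding S_def by (intro open_Collect_conj open_Collect_less continuous_intros)
  moreover have "h \<in> S" unfolding S_def using h by blast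
  ultimately have S: "open S" "h \<in> S" .
  have abs: "\<bar>e - 2 * y\<bar> = sgn e * (e - 2 * y)" if "y \<in> S" for y
  proof -
    have "0 < (e - 2 * y) * e" using that by (simp add: S_def algebra_simps power2_eq_square)
    then show ?thesis by (auto simp: zero_less_mult_iff sgn_if)
  qed
  have I_eq: "I y = sgn e / (2 * pi) *
      (2 * (e - 2 * y) * arc_integral (\<lambda>\<theta>. (sin \<theta>)\<^sup>2) (inv_sqrt_quad r) e (2 * y))" if "y \<in> S" for y
  proof -
    have ye: "0 < 2 * y * e" "2 * y * e < e\<^sup>2" using that unfolding S_def by blast+
    then have ne: "2 * y \<noteq> e" by (auto simp: power2_eq_square)
    show ?thesis
      unfolding I[OF ye] action_integral_eq_arc[OF ye(1) er ne] abs[OF that] by (simp add: field_simps)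
  qed
  have scale: "((\<lambda>y. F (2 * y)) has_field_derivative 2 * F') (at y)"
    if "(F has_field_derivative F') (at (2 * y))" for F F' and y :: real
  proof -
    have "((\<lambda>y. 2 * y) has_field_derivative 2) (at y)" by (auto intro!: derivative_eq_intros)
    from DERIV_chain2[OF that this] show ?thesis by (simp add: mult.commute)
  qed
  have d1: "(I has_field_derivative - sgn e / pi * P0 (2 * y)) (at y)" if y: "y \<in> S" for y
  proof -
    have "0 < 2 * y * e" using y unfolding S_def by blast
    from DERIV_cmult[OF scale[OF period_as_action_derivative[OF er this]], of "sgn e / (2 * pi)"]
    have "((\<lambda>y. sgn e / (2 * pi) *
      (2 * (e - 2 * y) * arc_integral (\<lambda>\<theta>. (sin \<theta>)\<^sup>2) (inv_sqrt_quad r) e (2 * y))) has_field_derivative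
      - sgn e / pi * P0 (2 * y)) (at y)" by (simp add: P0_def)
    then show ?thesis
      by (rule has_field_derivative_transform_within_open[OF _ S(1) y]) (simp add: I_eq)
  qed
  have d2: "((\<lambda>y. - sgn e / pi * P0 (2 * y)) has_field_derivative - 2 * sgn e / pi * P1 (2 * y)) (at y)"
    if y: "y \<in> S" for y
  proof -
    have "0 < 2 * y * e" using y unfolding S_def by blast
    from arc_integral_derivatives(1)[OF er this continuous_on_const[of _ 1]]
    have "(P0 has_field_derivative P1 (2 * y)) (at (2 * y))" by (simp add: P0_def P1_def)
    from DERIV_cmult[OF scale[OF this], of "- sgn e / pi"] show ?thesis by (simp add: mult_ac)
  qed
  have d3: "((\<lambda>y. - 2 * sgn e / pi * P1 (2 * y)) has_field_derivative - 4 * sgn e / pi * P2 (2 * y)) (at y)"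
    if y: "y \<in> S" for y
  proof -
    have ye: "0 < 2 * y * e" using y unfolding S_def by blast
    have "continuous_on {0..pi/2} (\<lambda>\<theta>::real. (cos \<theta>)\<^sup>2)" by (intro continuous_intros)
    from arc_integral_derivatives(2)[OF er ye this]
    have "(P1 has_field_derivative P2 (2 * y)) (at (2 * y))"
      by (simp add: P1_def P2_def eval_nat_numeral mult.assoc)
    from DERIV_cmult[OF scale[OF this], of "- 2 * sgn e / pi"] show ?thesis by (simp add: mult_ac)
  qed
  have fuchs: "4 * (2 * h * (2 * h - e) * (2 * h - r)) * P2 (2 * h)
     + 4 * (3 * (2 * h)\<^sup>2 - 2 * (e + r) * (2 * h) + e * r) * P1 (2 * h)
     + (3 * (2 * h) - (e + r)) * P0 (2 * h) = 0"
    using period_picard_fuchs[OF er h(1)] unfolding P0_def P1_def P2_def .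
  \<comment> \<open>The factors \<open>2\<close> and \<open>4\<close> come from \<open>a = 2 * h\<close> by the chain rule.\<close>
  have lin: "A * (- 4 * sgn e / pi * p2) + 2 * B * (- 2 * sgn e / pi * p1) + D * (- sgn e / pi * p0)
     = - sgn e / pi * (4 * A * p2 + 4 * B * p1 + D * p0)" for A B D p0 p1 p2 :: real
    by (simp add: algebra_simps)
  from iterated_deriv_on_open[OF S d1 d2 d3]
  have "\<forall>k<3. (deriv ^^ k) I differentiable (at h)"
    and der: "deriv I h = - sgn e / pi * P0 (2 * h)" "(deriv ^^ 2) I h = - 2 * sgn e / pi * P1 (2 * h)"
      "(deriv ^^ 3) I h = - 4 * sgn e / pi * P2 (2 * h)" by auto
  then show ?thesis unfolding der lin fuchs by simp
qed

theorem theorem3p3: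
  fixes \<Theta>1 \<Theta>2 \<Theta>3 \<rho> \<kappa> h :: real and I :: "real \<Rightarrow> real"
  assumes "0 < \<Theta>1" and "\<Theta>1 < \<Theta>2" and "\<Theta>2 < \<Theta>3"
    and "\<rho> = euler_rho \<Theta>1 \<Theta>2 \<Theta>3"
    and "\<kappa> = euler_kappa \<rho>"
    and "(I = action_plus \<rho> \<and> 0 < 2 * h \<and> 2 * h < 1 / \<rho>) \<or>
         (I = action_minus \<rho> \<and> - \<rho> < 2 * h \<and> 2 * h < 0)"
  shows "(\<forall>k<3. (deriv ^^ k) I differentiable (at h)) \<and>
         w_sq \<kappa> (2 * h) * (deriv ^^ 3) I h
           + 2 * (12 * h\<^sup>2 + 4 * \<kappa> * h - 1) * (deriv ^^ 2) I h
           + (6 * h + \<kappa>) * deriv I h = 0"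
proof -
  have \<rho>: "0 < \<rho>" using euler_rho_pos assms(1-4) by simp
  \<comment> \<open>Only the product and the sum of the two nonzero roots enter the coefficients, so that
    \<open>e\<close> and \<open>r\<close> may be interchanged between the two cases.\<close>
  have coeffs: "w_sq \<kappa> (2 * h) = 2 * h * (2 * h - e) * (2 * h - r)"
      "12 * h\<^sup>2 + 4 * \<kappa> * h - 1 = 3 * (2 * h)\<^sup>2 - 2 * (e + r) * (2 * h) + e * r"
      "6 * h + \<kappa> = 3 * (2 * h) - (e + r)"
    if "e * r = -1" "e + r = - \<kappa>" for e r
  proof -
    have r: "\<kappa> = - (e + r)" using that by simp
    have "w_sq \<kappa> (2 * h) = 2 * h * ((2 * h)\<^sup>2 - (e + r) * (2 * h) + e * r)"
      unfolding w_sq_def that by simp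
    then show "w_sq \<kappa> (2 * h) = 2 * h * (2 * h - e) * (2 * h - r)"
      by (simp add: algebra_simps power2_eq_square)
    show "12 * h\<^sup>2 + 4 * \<kappa> * h - 1 = 3 * (2 * h)\<^sup>2 - 2 * (e + r) * (2 * h) + e * r"
      unfolding that by (simp add: power2_eq_square)
    show "6 * h + \<kappa> = 3 * (2 * h) - (e + r)" unfolding that by simp
  qed
  from assms(6) show ?thesis
  proof (elim disjE conjE)
    assume h: "I = action_plus \<rho>" "0 < 2 * h" "2 * h < 1 / \<rho>"
    have k: "1 / \<rho> * - \<rho> = -1" "1 / \<rho> + - \<rho> = - \<kappa>"
      using \<rho> by (simp_all add: assms(5) euler_kappa_def)
    have I: "I y = 1 / (2 * pi) * integral (closed_segment (2 * y) (1 / \<rho>))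
        (\<lambda>x. sqrt ((x - 2 * y) / (x * (x - - \<rho>) * (1 / \<rho> - x))))"
      if "2 * y * (1 / \<rho>) < (1 / \<rho>)\<^sup>2" for y
    proof -
      have "2 * y < 1 / \<rho>"
        using that \<rho> unfolding power2_eq_square by (subst (asm) mult_less_cancel_right_pos) auto
      then show ?thesis
        by (simp add: h(1) action_plus_def action_integrand_def[abs_def] closed_segment_eq_real_ivl)
    qed
    have "0 < 2 * h * (1 / \<rho>)" "2 * h * (1 / \<rho>) < (1 / \<rho>)\<^sup>2"
      using h \<rho> mult_strict_right_mono[of "2 * h" "1 / \<rho>" "1 / \<rho>"]
      by (simp_all add: power2_eq_square)
    from action_picard_fuchs[OF _ I this] show ?thesis
      unfolding coeffs[OF k] k(1) by simp
  next
    assume h: "I = action_minus \<rho>" "- \<rho> < 2 * h" "2 * h < 0"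
    have k: "- \<rho> * (1 / \<rho>) = -1" "- \<rho> + 1 / \<rho> = - \<kappa>"
      using \<rho> by (simp_all add: assms(5) euler_kappa_def)
    have I: "I y = 1 / (2 * pi) * integral (closed_segment (2 * y) (- \<rho>))
        (\<lambda>x. sqrt ((x - 2 * y) / (x * (x - 1 / \<rho>) * (- \<rho> - x))))"
      if "2 * y * (- \<rho>) < (- \<rho>)\<^sup>2" for y
    proof -
      have "- \<rho> < 2 * y"
        using that \<rho> unfolding power2_eq_square by (subst (asm) mult_less_cancel_right_neg) auto
      moreover have "(x - 1 / \<rho>) * (- \<rho> - x) = (x + \<rho>) * (1 / \<rho> - x)" for x
        using \<rho> by (simp add: field_simps)
      ultimately show ?thesis
        by (simp add: h(1) action_minus_def action_integrand_def[abs_def] mult.assoc closed_segment_eq_real_ivl)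
    qed
    have "0 < 2 * h * (- \<rho>)" "2 * h * (- \<rho>) < (- \<rho>)\<^sup>2"
      using h \<rho> mult_strict_right_mono_neg[of "- \<rho>" "2 * h" "- \<rho>"]
      by (simp_all add: power2_eq_square mult_neg_pos)
    from action_picard_fuchs[OF _ I this] show ?thesis
      unfolding coeffs[OF k] k(1) by simp
  qed
qed

end
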